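(* Let $(X,d)$ be a compact metric space such that the set $$X-X:=\{f\in L^\infty(X): f=d(x,\cdot)-d(y,\cdot),\ x,y\in X\}$$ is an almost homogeneous subset of $L^\infty(X)$. Then, for some $N\in\mathbb N$, there exists an injective almost bi-Lipschitz map $f:(X,d)\to\mathbb R^N$.
   Context: $L^\infty(X)$ is the space of bounded real functions on $X$ with the supremum norm; $X-X$ carries the induced metric. For $x>0$, $\operatorname{slog}(x):=\log(x+x^{-1})$. For a metric space $(Y,\rho_Y)$ and $0<\rho<r$, $\mathcal N_Y(r,\rho)$ denotes the minimum number of balls of radius $\rho$ sufficient to cover any ball of radius $r$ in $Y$. $Y$ is almost homogeneous if there exist $\alpha,\beta\ge0$, $M\ge1$, $s\ge0$ such that $\mathcal N_Y(r,\rho)\le M\left(\frac r\rho\right)^s\operatorname{slog}(r)^\beta\operatorname{slog}(\rho)^\alpha$ for all $0<\rho<r<\infty$. A map $f:(X,d)\to\mathbb R^N$ is almost bi-Lipschitz if there exist $\gamma\ge0$ and $L>0$ with $\frac1L\frac{d(x,y)}{\operatorname{slog}(d(x,y))^\gamma}\le|f(x)-f(y)|\le L\,d(x,y)$ for all $x,y\in X$, $x\ne y$. *)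

theory Defs
  imports "HOL-Analysis.Analysis"
begin

text \<open>Metric spaces are values of the library type \<^typ>\<open>'a metric\<close> (a carrier \<^const>\<open>mspace\<close> with a
  distance \<^const>\<open>mdist\<close>), so the space is an arbitrary metric space and not a subset of one whose
  distance is fixed by a type class.\<close>

definition slog :: "real \<Rightarrow> real" where
  "slog x = ln (x + inverse x)"

text \<open>The value is \<open>\<infinity>\<close> if no finite number of balls suffices.  Balls are open and their
  centres lie in the space itself.\<close>

definition covering_number :: "'a metric \<Rightarrow> real \<Rightarrow> real \<Rightarrow> enat" where
  "covering_number Y r \<rho> =
     Inf {enat n | n. \<forall>y \<in> mspace Y. \<exists>C. C \<subseteq> mspace Y \<and> finite C \<and> card C \<le> n
            \<and> mball_of Y y r \<subseteq> (\<Union>c\<in>C. mball_of Y c \<rho>)}"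

definition almost_homogeneous :: "'a metric \<Rightarrow> bool" where
  "almost_homogeneous Y \<longleftrightarrow>
     (\<exists>\<alpha> \<beta> M s :: real. \<alpha> \<ge> 0 \<and> \<beta> \<ge> 0 \<and> M \<ge> 1 \<and> s \<ge> 0 \<and>
        (\<forall>r \<rho>. 0 < \<rho> \<and> \<rho> < r \<longrightarrow>
           ereal_of_enat (covering_number Y r \<rho>)
             \<le> ereal (M * (r / \<rho>) powr s * slog r powr \<beta> * slog \<rho> powr \<alpha>)))"

text \<open>Bounded real functions on the carrier with the supremum metric; to be determined by their
  values on the carrier, functions are \<^const>\<open>undefined\<close> outside it.\<close>

abbreviation Linfty :: "'a metric \<Rightarrow> ('a \<Rightarrow> real) metric" where
  "Linfty X \<equiv> funspace (mspace X) euclidean_metric"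

definition distance_differences :: "'a metric \<Rightarrow> ('a \<Rightarrow> real) set" where
  "distance_differences X =
     {f \<in> mspace (Linfty X). \<exists>x \<in> mspace X. \<exists>y \<in> mspace X.
        f = (\<lambda>z \<in> mspace X. mdist X x z - mdist X y z)}"

text \<open>Points of \<open>\<real>\<^sup>N\<close> are the elements of \<^term>\<open>topspace (Euclidean_space N)\<close>, that is, real
  sequences vanishing from index \<open>N\<close> on.\<close>

definition almost_bi_Lipschitz :: "'a metric \<Rightarrow> nat \<Rightarrow> ('a \<Rightarrow> nat \<Rightarrow> real) \<Rightarrow> bool" where
  "almost_bi_Lipschitz X N f \<longleftrightarrow>
     f \<in> mspace X \<rightarrow> topspace (Euclidean_space N) \<and>
     (\<exists>\<gamma> L :: real. \<gamma> \<ge> 0 \<and> L > 0 \<and>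
        (\<forall>x \<in> mspace X. \<forall>y \<in> mspace X. x \<noteq> y \<longrightarrow>
           1 / L * (mdist X x y / slog (mdist X x y) powr \<gamma>)
             \<le> L2_set (\<lambda>i. f x i - f y i) {..<N} \<and>
           L2_set (\<lambda>i. f x i - f y i) {..<N} \<le> L * mdist X x y))"

end

theory Submission
  imports Defs "HOL-Probability.Infinite_Product_Measure"
begin

text \<open>
  The embedding has coordinates \<open>f\<^sub>i x = (\<Sum>j. \<Xi> i j * d(x, z\<^sub>j) / (j + 1)\<^sup>2)\<close>, with points \<open>z\<^sub>j\<close> chosen
  from the geometry of \<open>X\<close> and random coefficients \<open>\<Xi> i j\<close>, independent and uniform in \<open>[0, 1]\<close>.  Since the
  weights are summable, every choice of coefficients gives a Lipschitz map, and only the lower bound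
  is at stake.  Each \<open>f\<^sub>i\<close> is the composition of \<open>x \<mapsto> d(x, \<cdot>)\<close> with a bounded linear functional, so
  \<open>f\<^sub>i x - f\<^sub>i y\<close> is that functional at the point \<open>d(x, \<cdot>) - d(y, \<cdot>)\<close> of \<open>X - X\<close>: this is why the
  hypothesis is about \<open>X - X\<close> and not merely about \<open>X\<close>.

  Split the pairs \<open>(x, y)\<close> into the annuli \<open>r/2 \<le> d(x, y) < r\<close> for \<open>r = R / 2\<^sup>n\<close>.  The \<open>slog\<close> factors at
  these scales are \<open>O(n + 1)\<close>, so almost homogeneity says that the \<open>n\<close>-th annulus is covered by
  \<open>O(t\<^sup>S (n + 1)\<^sup>B)\<close> balls of radius \<open>r / t\<close> (lemma \<open>almost_homogeneous_covering\<close>).  This is used at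
  two different resolutions.

  The coarse net, \<open>t = 8\<close>, gives the points \<open>z\<^sub>j\<close>: an element \<open>d(x', \<cdot>) - d(y', \<cdot>)\<close> attains its
  norm at \<open>y'\<close>, so evaluation at the points \<open>y'\<close> of the net detects every pair of the annulus
  up to a factor.  As the net has polynomially many elements, the evaluation point for a pair of the
  \<open>n\<close>-th annulus occurs at an index \<open>j\<close> polynomial in \<open>n\<close>, and its weight is at least a power of
  \<open>1 / (n + 1)\<close> (lemma \<open>norming_sequence\<close>).  Hence a single random coordinate is unlikely to be small at
  a given pair: conditioned on all coefficients but the one at \<open>j\<close>, it runs through an interval of
  length at least \<open>r\<close> divided by a power of \<open>n + 1\<close> (lemma \<open>small_ball_cube\<close>).

  The fine net, with \<open>t\<close> a multiple of \<open>(n + 1)\<^sup>q\<close>, serves for a union bound.  With a threshold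
  \<open>\<tau> = \<delta> r / (n + 1)\<^sup>q\<close> the failure probability of one coordinate at one pair is
  \<open>O(\<delta> / (n + 1))\<close>.  The exponent \<open>q\<close> depends on the coarse net only, so it is fixed before the
  polynomial size of the fine net is known; that size is then beaten by taking \<open>N\<close> independent
  coordinates, which raise the failure probability to the power \<open>N\<close>.  For small \<open>\<delta>\<close> the
  total failure probability is less than 1, so suitable coefficients exist (lemma
  \<open>exists_separating_coefficients\<close>).  At distances of order \<open>R / 2\<^sup>n\<close> the loss \<open>(n + 1)\<^sup>q\<close> is at most a
  constant times \<open>slog(d(x, y))\<^sup>q\<close>, which gives the theorem with \<open>\<gamma> = q\<close>.
\<close>

section \<open>The slowly varying logarithm at dyadic scales\<close>

lemma slog_ge_ln2:
  assumes "0 < x" shows "ln 2 \<le> slog x"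
proof -
  have "2 \<le> x + inverse x"
    using assms sum_squares_bound[of x 1] by (simp add: field_simps power2_eq_square)
  then show ?thesis unfolding slog_def using assms by simp
qed

lemma slog_pos: "0 < x \<Longrightarrow> 0 < slog x"
  using slog_ge_ln2[of x] ln_gt_zero[of "2::real"] by linarith

lemma slog_ge_ln_inverse:
  assumes "0 < x" shows "- ln x \<le> slog x"
proof -
  have "inverse x \<le> x + inverse x" using assms by simp
  then have "ln (inverse x) \<le> ln (x + inverse x)" using assms by (subst ln_le_cancel_iff) (auto intro: add_pos_pos)
  then show ?thesis using assms by (simp add: slog_def ln_inverse)
qed

text \<open>The factor \<open>n\<close> comes from \<open>ln (2\<^sup>n)\<close>, and \<open>ln t\<close> is estimated by \<open>t\<close>: a polynomial loss in
  \<open>t\<close> only changes the exponent of the covering bound, and the product form can be raised to powers.\<close>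

lemma slog_dyadic_le:
  fixes R t :: real
  assumes "1 \<le> R" "1 \<le> t"
  shows "slog (R / 2 ^ n / t) \<le> (2 * R\<^sup>2 + 2) * (real n + 1) * t"
proof -
  let ?x = "R / 2 ^ n / t"
  have x: "0 < ?x" using assms by simp
  have "1 * 1 \<le> 2 ^ n * t" using assms by (intro mult_mono) auto
  then have xR: "?x \<le> R" using assms by (simp add: field_simps)
  have "?x\<^sup>2 \<le> R\<^sup>2" using x xR by (intro power_mono) auto
  moreover have "1 \<le> R\<^sup>2" using assms by simp
  ultimately have "?x\<^sup>2 + 1 \<le> 2 * R\<^sup>2" by linarith
  moreover have "?x + inverse ?x = (?x\<^sup>2 + 1) / ?x"
    using x by (metis add_divide_distrib inverse_eq_divide less_irrefl nonzero_mult_div_cancel_left power2_eq_square)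
  ultimately have "?x + inverse ?x \<le> (2 * R\<^sup>2) / ?x" using x by (metis divide_right_mono less_eq_real_def)
  also have "\<dots> = 2 * R * (2 ^ n * t)" using assms by (simp add: field_simps power2_eq_square)
  finally have "slog ?x \<le> ln (2 * R * (2 ^ n * t))"
    unfolding slog_def using x assms by (subst ln_le_cancel_iff) (auto intro!: add_pos_pos)
  also have "\<dots> = ln (2 * R) + (real n * ln 2 + ln t)"
    using assms by (simp add: ln_mult ln_realpow)
  also have "\<dots> \<le> 2 * R\<^sup>2 + (real n * 1 + t)"
  proof -
    have "ln (2 * R) \<le> 2 * R" "ln t \<le> t" "ln (2::real) \<le> 1"
      using assms ln_bound[of "2*R"] ln_bound[of t] ln_2_less_1 by auto
    moreover have "R \<le> R\<^sup>2" using assms by (simp add: power2_eq_square)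
    ultimately show ?thesis by (intro add_mono mult_left_mono) auto
  qed
  also have "\<dots> \<le> 2 * R\<^sup>2 * ((real n + 1) * t) + ((real n + 1) * t + (real n + 1) * t)"
  proof (intro add_mono)
    have "1 * 1 \<le> (real n + 1) * t" using assms by (intro mult_mono) auto
    then have "2 * R\<^sup>2 * 1 \<le> 2 * R\<^sup>2 * ((real n + 1) * t)" by (intro mult_left_mono) auto
    then show "2 * R\<^sup>2 \<le> 2 * R\<^sup>2 * ((real n + 1) * t)" by simp
    show "real n * 1 \<le> (real n + 1) * t" using assms by (intro mult_mono) auto
    have "1 * t \<le> (real n + 1) * t" using assms by (intro mult_mono) auto
    then show "t \<le> (real n + 1) * t" by simp
  qed
  finally show ?thesis by (simp add: algebra_simps)
qed

text \<open>The converse of the upper bound: at distances below \<open>R / 2\<^sup>n\<close> the factor \<open>slog d\<close> dominates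
  \<open>n + 1\<close>, so a loss that is a power of \<open>n + 1\<close> is a loss that is a power of \<open>slog d\<close>.\<close>

lemma Suc_scale_le_slog:
  assumes R: "1 \<le> R" and d: "0 < d" "d < R / 2 ^ n"
  shows "real n + 1 \<le> (4 * R + 4) * slog d"
proof -
  have "ln d \<le> ln (R / 2 ^ n)" using R d by simp
  also have "\<dots> = ln R - real n * ln 2" using R by (simp add: ln_div ln_realpow)
  finally have "real n * ln 2 \<le> slog d + ln R" using slog_ge_ln_inverse[OF d(1)] by linarith
  moreover have "ln R \<le> R" using R ln_bound[of R] by simp
  moreover have "1 / 2 \<le> ln (2::real)" using ln2_ge_two_thirds by linarith
  then have "real n * (1 / 2) \<le> real n * ln 2" "1 / 2 \<le> slog d"
    using slog_ge_ln2[OF d(1)] by (auto intro!: mult_left_mono simp del: times_divide_eq_right)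
  moreover define m where "m = (2 * R + 1) * slog d"
  have "(2 * R + 1) * (1 / 2) \<le> m"
    unfolding m_def using \<open>1 / 2 \<le> slog d\<close> R by (intro mult_left_mono) auto
  ultimately have "real n + 1 \<le> 2 * slog d + 2 * m" by (simp add: field_simps)
  then have "real n + 1 \<le> 2 * slog d + 2 * ((2 * R + 1) * slog d)" by (simp only: m_def)
  then show ?thesis by (simp add: algebra_simps)
qed

lemma powr_le_power:
  fixes x y :: real
  assumes "0 \<le> x" "x \<le> y" "1 \<le> y" "0 \<le> a"
  shows "x powr a \<le> y ^ nat \<lceil>a\<rceil>"
proof -
  have "x powr a \<le> y powr a" using assms by (intro powr_mono2) auto
  also have "\<dots> \<le> y powr real (nat \<lceil>a\<rceil>)" using assms by (intro powr_mono) auto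
  finally show ?thesis using assms powr_realpow[of y "nat \<lceil>a\<rceil>"] by simp
qed

section \<open>Coverings of the set of distance differences\<close>

text \<open>These functions are not cut off outside \<open>mspace X\<close>, which keeps sums and evaluations free of side
  conditions; restricted to \<open>mspace X\<close> they are the elements of \<open>X - X\<close>.\<close>

definition pair_gap :: "'a metric \<Rightarrow> 'a \<times> 'a \<Rightarrow> 'a \<Rightarrow> real" where
  "pair_gap X p z = mdist X (fst p) z - mdist X (snd p) z"

lemma abs_pair_gap_le:
  assumes "p \<in> mspace X \<times> mspace X" "z \<in> mspace X"
  shows "\<bar>pair_gap X p z\<bar> \<le> mdist X (fst p) (snd p)"
  using assms mdist_triangle[of "fst p" X "snd p" z] mdist_triangle[of "snd p" X "fst p" z]
    mdist_commute[of X "fst p" "snd p"]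
  by (auto simp: pair_gap_def)

text \<open>Together with the previous bound: a distance difference attains its supremum norm
  \<open>d(x, y)\<close> at \<open>y\<close>.  Evaluation at \<open>y\<close> is therefore a norming functional.\<close>

lemma pair_gap_snd: "p \<in> mspace X \<times> mspace X \<Longrightarrow> pair_gap X p (snd p) = mdist X (fst p) (snd p)"
  by (auto simp: pair_gap_def)

lemma covering_number_attained:
  assumes "covering_number Y r \<rho> \<noteq> \<infinity>" "y \<in> mspace Y"
  obtains C where "C \<subseteq> mspace Y" "finite C" "enat (card C) \<le> covering_number Y r \<rho>"
    "mball_of Y y r \<subseteq> (\<Union>c\<in>C. mball_of Y c \<rho>)"
proof -
  let ?A = "{enat n | n. \<forall>y \<in> mspace Y. \<exists>C. C \<subseteq> mspace Y \<and> finite C \<and> card C \<le> n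
            \<and> mball_of Y y r \<subseteq> (\<Union>c\<in>C. mball_of Y c \<rho>)}"
  have "?A \<noteq> {}"
    using assms(1) unfolding covering_number_def by (metis (lifting) Inf_enat_def)
  then have "Inf ?A \<in> ?A" by (rule wellorder_InfI[OF ex_in_conv[THEN iffD2, THEN someI_ex]])
  then show thesis
    using assms(2) that unfolding covering_number_def by fastforce
qed

lemma pair_gap_in_Linfty:
  assumes "x \<in> mspace X" "y \<in> mspace X"
  shows "restrict (pair_gap X (x, y)) (mspace X) \<in> mspace (submetric (Linfty X) (distance_differences X))"
proof -
  have "\<bar>pair_gap X (x, y) z\<bar> \<le> mdist X x y" if "z \<in> mspace X" for z
    using abs_pair_gap_le[of "(x, y)" X z] assms that by simp
  then have "restrict (pair_gap X (x, y)) (mspace X) \<in> mspace (Linfty X)"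
    by (auto simp: Met_TC.fspace_def bounded_iff)
  with assms show ?thesis
    unfolding distance_differences_def pair_gap_def by auto
qed

lemma Linfty_dist_less_imp_pointwise:
  assumes "f \<in> mspace (Linfty X)" "g \<in> mspace (Linfty X)" "mdist (Linfty X) f g < a" "z \<in> mspace X"
  shows "\<bar>f z - g z\<bar> < a"
  using funspace_mdist_le[OF assms(1,2), of "mdist (Linfty X) f g"] assms(3,4)
  by (force simp: dist_real_def)

text \<open>The form in which almost homogeneity is used.  The balls of radius \<open>R / 2\<^sup>n\<close> are those centred
  at \<open>0 \<in> X - X\<close>, that is, all pairs at distance less than \<open>R / 2\<^sup>n\<close>; natural exponents
  absorb the powers of \<open>slog\<close>.\<close>

definition polynomially_covered :: "'a metric \<Rightarrow> real \<Rightarrow> real \<Rightarrow> nat \<Rightarrow> nat \<Rightarrow> bool" where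
  "polynomially_covered X R C S B \<longleftrightarrow>
     (\<forall>n t. 1 < t \<longrightarrow> (\<exists>P \<subseteq> mspace X \<times> mspace X. finite P \<and> real (card P) \<le> C * t ^ S * (real n + 1) ^ B \<and>
       (\<forall>p \<in> mspace X \<times> mspace X. mdist X (fst p) (snd p) < R / 2 ^ n \<longrightarrow>
          (\<exists>p' \<in> P. \<forall>z \<in> mspace X. \<bar>pair_gap X p z - pair_gap X p' z\<bar> < R / 2 ^ n / t))))"

lemma almost_homogeneous_covering:
  fixes R :: real
  assumes ah: "almost_homogeneous (submetric (Linfty X) (distance_differences X))"
    and R: "1 \<le> R"
  obtains C :: real and S B :: nat where "1 \<le> C" "polynomially_covered X R C S B"
proof -
  let ?Y = "submetric (Linfty X) (distance_differences X)"
  obtain \<alpha> \<beta> M s where par: "0 \<le> \<alpha>" "0 \<le> \<beta>" "1 \<le> M" "0 \<le> s" and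
    cov: "\<And>r \<rho>. 0 < \<rho> \<Longrightarrow> \<rho> < r \<Longrightarrow> ereal_of_enat (covering_number ?Y r \<rho>)
             \<le> ereal (M * (r / \<rho>) powr s * slog r powr \<beta> * slog \<rho> powr \<alpha>)"
    using ah unfolding almost_homogeneous_def by metis
  define K where "K = 2 * R\<^sup>2 + 2"
  have K: "1 \<le> K" by (simp add: K_def)
  let ?s = "nat \<lceil>s\<rceil>" and ?a = "nat \<lceil>\<alpha>\<rceil>" and ?b = "nat \<lceil>\<beta>\<rceil>"
  define C where "C = M * K ^ (?b + ?a)"
  show thesis
  proof
    have "1 * 1 \<le> M * K ^ (?b + ?a)" using par K by (intro mult_mono one_le_power) auto
    then show "1 \<le> C" by (simp add: C_def)
  next
    show "polynomially_covered X R C (?s + ?a) (?b + ?a)"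
      unfolding polynomially_covered_def
    proof (intro allI impI)
      fix n :: nat and t :: real
      assume t: "1 < t"
      define r where "r = R / 2 ^ n"
      have r: "0 < r" using R by (simp add: r_def)
      have rt: "0 < r / t" "r / t < r" using r t by (auto simp: field_simps)
      let ?bd = "M * (r / (r / t)) powr s * slog r powr \<beta> * slog (r / t) powr \<alpha>"
      have "slog r powr \<beta> \<le> (K * (real n + 1)) ^ ?b"
      proof (rule powr_le_power)
        show "slog r \<le> K * (real n + 1)" using slog_dyadic_le[OF R, of 1 n] by (simp add: r_def K_def)
        show "1 \<le> K * (real n + 1)" using mult_mono[of 1 K 1 "real n + 1"] K by simp
      qed (use par slog_pos[OF r] in auto)
      moreover have "slog (r / t) powr \<alpha> \<le> (K * (real n + 1) * t) ^ ?a"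
      proof (rule powr_le_power)
        show "slog (r / t) \<le> K * (real n + 1) * t" using slog_dyadic_le[OF R, of t n] t by (simp add: r_def K_def)
        have "1 * 1 * 1 \<le> K * (real n + 1) * t" using K t by (intro mult_mono) auto
        then show "1 \<le> K * (real n + 1) * t" by simp
      qed (use par slog_pos[OF rt(1)] in auto)
      moreover have "(r / (r / t)) powr s \<le> t ^ ?s"
        by (rule powr_le_power) (use t r par in auto)
      ultimately have "?bd \<le> M * t ^ ?s * (K * (real n + 1)) ^ ?b * (K * (real n + 1) * t) ^ ?a"
        using par t K by (intro mult_mono) auto
      also have "\<dots> = C * t ^ (?s + ?a) * (real n + 1) ^ (?b + ?a)"
        by (simp add: C_def power_mult_distrib power_add mult_ac)
      finally have bd: "?bd \<le> C * t ^ (?s + ?a) * (real n + 1) ^ (?b + ?a)" .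
      let ?N = "covering_number ?Y r (r / t)"
      have N: "ereal_of_enat ?N \<le> ereal ?bd" by (rule cov[OF rt])
      then have Nfin: "?N \<noteq> \<infinity>" by (metis ereal_infty_less_eq2(1) ereal_of_enat_simps(2) PInfty_neq_ereal(1))
      show "\<exists>P \<subseteq> mspace X \<times> mspace X. finite P \<and> real (card P) \<le> C * t ^ (?s + ?a) * (real n + 1) ^ (?b + ?a) \<and>
         (\<forall>p \<in> mspace X \<times> mspace X. mdist X (fst p) (snd p) < R / 2 ^ n \<longrightarrow>
            (\<exists>p' \<in> P. \<forall>z \<in> mspace X. \<bar>pair_gap X p z - pair_gap X p' z\<bar> < R / 2 ^ n / t))"
      proof (cases "mspace X = {}")
        case True
        have "0 \<le> C" using par K by (simp add: C_def)
        with True t show ?thesis by (intro exI[of _ "{}"]) auto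
      next
        case False
        then obtain x0 where x0: "x0 \<in> mspace X" by auto
        let ?res = "\<lambda>p. restrict (pair_gap X p) (mspace X)"
        have in_Y: "?res p \<in> mspace ?Y" if "p \<in> mspace X \<times> mspace X" for p
          using pair_gap_in_Linfty[of "fst p" X "snd p"] that by (simp only: prod.collapse mem_Times_iff)
        have zero: "?res (x0, x0) \<in> mspace ?Y" using in_Y x0 by auto
        obtain F where F: "F \<subseteq> mspace ?Y" "finite F" "enat (card F) \<le> ?N"
           and Fcov: "mball_of ?Y (?res (x0, x0)) r \<subseteq> (\<Union>c\<in>F. mball_of ?Y c (r / t))"
          using covering_number_attained[OF Nfin zero] by metis
        have "ereal_of_enat (enat (card F)) \<le> ereal ?bd"
          using F(3) N by (meson ereal_of_enat_le_iff order_trans)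
        then have cardF: "real (card F) \<le> ?bd" by simp
        have "F \<subseteq> ?res ` (mspace X \<times> mspace X)"
        proof
          fix f assume "f \<in> F"
          then have "f \<in> distance_differences X" using F(1) by auto
          then obtain x y where xy: "x \<in> mspace X" "y \<in> mspace X"
            and f: "f = (\<lambda>z \<in> mspace X. mdist X x z - mdist X y z)"
            unfolding distance_differences_def by blast
          have "f = ?res (x, y)" unfolding f pair_gap_def by (auto simp: restrict_def)
          then show "f \<in> ?res ` (mspace X \<times> mspace X)" using xy by blast
        qed
        then obtain P where P: "P \<subseteq> mspace X \<times> mspace X" "finite P" "F = ?res ` P" "card P = card F"
          using F(2) by (metis (no_types, lifting) card_image finite_image_iff subset_image_inj)
        show ?thesis
        proof (intro exI[of _ P] conjI ballI impI)
          show "real (card P) \<le> C * t ^ (?s + ?a) * (real n + 1) ^ (?b + ?a)"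
            using cardF bd P(4) by simp
          fix p assume p: "p \<in> mspace X \<times> mspace X" "mdist X (fst p) (snd p) < R / 2 ^ n"
          have "mdist (Linfty X) (?res (x0, x0)) (?res p) \<le> mdist X (fst p) (snd p)"
            using zero in_Y[OF p(1)] abs_pair_gap_le[OF p(1)] False
            by (subst funspace_mdist_le) (auto simp: pair_gap_def dist_real_def abs_minus_commute)
          then have "?res p \<in> mball_of ?Y (?res (x0, x0)) r"
            using zero in_Y[OF p(1)] p(2) by (simp add: r_def)
          then obtain p' where p': "p' \<in> P" "?res p \<in> mball_of ?Y (?res p') (r / t)"
            using Fcov P(3) by blast
          show "\<exists>p' \<in> P. \<forall>z \<in> mspace X. \<bar>pair_gap X p z - pair_gap X p' z\<bar> < R / 2 ^ n / t"
          proof (intro bexI[OF _ p'(1)] ballI)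
            fix z assume z: "z \<in> mspace X"
            have "\<bar>?res p' z - ?res p z\<bar> < r / t"
              using Linfty_dist_less_imp_pointwise[OF _ _ _ z, of "?res p'" "?res p" "r / t"] p'(2) by simp
            then show "\<bar>pair_gap X p z - pair_gap X p' z\<bar> < R / 2 ^ n / t"
              using z by (simp add: r_def abs_minus_commute)
          qed
        qed (use P in auto)
      qed
    qed
  qed
qed

section \<open>Small ball probabilities for random series\<close>

text \<open>Each coordinate space is the interval itself and not \<open>\<real>\<close> with a measure concentrated on it, so
  that every point of the product, and not only almost every one, has coordinates in \<open>[0, 1]\<close> and
  makes the random series converge.\<close>

definition cube :: "(nat \<Rightarrow> real) measure" where
  "cube = (\<Pi>\<^sub>M j\<in>UNIV. restrict_space lborel {0..1})"

lemma prob_space_unit_interval: "prob_space (restrict_space lborel {0..1::real})"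
  by (rule prob_spaceI) (simp add: emeasure_restrict_space)

lemma prob_space_cube: "prob_space cube"
  unfolding cube_def by (rule prob_space_PiM) (rule prob_space_unit_interval)

lemma space_cube: "space cube = UNIV \<rightarrow>\<^sub>E {0..1}"
  by (simp add: cube_def space_PiM)

lemma measurable_cube_component [measurable]: "(\<lambda>\<xi>. \<xi> j) \<in> borel_measurable cube"
proof -
  have "(\<lambda>\<xi>. \<xi> j) \<in> measurable cube (restrict_space lborel {0..1})"
    unfolding cube_def by (rule measurable_component_singleton) simp
  then show ?thesis
    using measurable_restrict_space2_iff[of "\<lambda>\<xi>. \<xi> j" cube lborel "{0..1}"] by simp
qed

lemma summable_cube:
  assumes "\<xi> \<in> space cube" "summable (\<lambda>j. \<bar>c j\<bar>)"
  shows "summable (\<lambda>j. \<xi> j * c j)"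
  using assms(2)
proof (rule summable_comparison_test')
  fix j
  have "0 \<le> \<xi> j" "\<xi> j \<le> 1" using assms(1) by (auto simp: space_cube PiE_iff)
  then show "norm (\<xi> j * c j) \<le> \<bar>c j\<bar>" by (simp add: abs_mult mult_left_le_one_le)
qed

lemma emeasure_slab_le:
  fixes a c \<tau> :: real
  assumes "c \<noteq> 0" "0 \<le> \<tau>" "A \<subseteq> {x \<in> {0..1}. \<bar>x * c + a\<bar> \<le> \<tau>}"
  shows "emeasure (restrict_space lborel {0..1}) A \<le> ennreal (2 * \<tau> / \<bar>c\<bar>)"
proof (cases "A \<in> sets (restrict_space lborel {0..1})")
  case True
  have "A \<subseteq> {- a / c - \<tau> / \<bar>c\<bar> .. - a / c + \<tau> / \<bar>c\<bar>}"
  proof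
    fix x assume "x \<in> A"
    then have "\<bar>x * c + a\<bar> \<le> \<tau>" using assms by auto
    moreover have "x * c + a = (x + a / c) * c" using assms by (simp add: field_simps)
    ultimately have "\<bar>x + a / c\<bar> \<le> \<tau> / \<bar>c\<bar>"
      using assms by (simp add: abs_mult pos_le_divide_eq)
    then show "x \<in> {- a / c - \<tau> / \<bar>c\<bar> .. - a / c + \<tau> / \<bar>c\<bar>}" by auto
  qed
  then have "emeasure lborel A \<le> emeasure lborel {- a / c - \<tau> / \<bar>c\<bar> .. - a / c + \<tau> / \<bar>c\<bar>}"
    by (intro emeasure_mono) auto
  also have "\<dots> = ennreal (2 * \<tau> / \<bar>c\<bar>)"
    using assms by (subst emeasure_lborel_Icc) (auto intro!: divide_nonneg_nonneg add_nonneg_nonneg simp: le_diff_eq)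
  finally show ?thesis using True sets.sets_into_space[OF True] by (subst emeasure_restrict_space) auto
qed (simp add: emeasure_notin_sets)

text \<open>One coefficient suffices: for fixed values of the other variables, the condition confines the
  variable \<open>\<xi> k\<close> to an interval of length \<open>2 \<tau> / \<bar>c k\<bar>\<close>, and Fubini's theorem integrates this bound.\<close>

lemma small_ball_cube:
  fixes c :: "nat \<Rightarrow> real"
  assumes sm: "summable (\<lambda>j. \<bar>c j\<bar>)" and ck: "c k \<noteq> 0" and \<tau>: "0 \<le> \<tau>"
  shows "emeasure cube {\<xi> \<in> space cube. \<bar>\<Sum>j. \<xi> j * c j\<bar> \<le> \<tau>} \<le> ennreal (2 * \<tau> / \<bar>c k\<bar>)"
proof -
  let ?U = "restrict_space lborel {0..1::real}"
  let ?I = "UNIV - {k}"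
  let ?P = "\<Pi>\<^sub>M j\<in>?I. ?U"
  let ?B = "{\<xi> \<in> space cube. \<bar>\<Sum>j. \<xi> j * c j\<bar> \<le> \<tau>}"
  let ?upd = "\<lambda>(x, \<xi>). \<xi>(k := x)"
  interpret U: prob_space ?U by (rule prob_space_unit_interval)
  interpret P: prob_space ?P by (rule prob_space_PiM) (rule prob_space_unit_interval)
  interpret UP: pair_sigma_finite ?U ?P ..
  have B: "?B \<in> sets cube" by measurable
  \<comment> \<open>Splits off the coordinate \<open>k\<close> of the infinite product.\<close>
  have cube: "distr (?U \<Otimes>\<^sub>M ?P) cube ?upd = cube"
    using distr_pair_PiM_eq_PiM[of ?I "\<lambda>_. ?U" k] prob_space_unit_interval
    by (simp add: cube_def insert_UNIV insert_Diff_single)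
  have upd: "?upd \<in> measurable (?U \<Otimes>\<^sub>M ?P) cube"
    using measurable_fun_upd[of "UNIV" ?I k "\<lambda>p. snd p" "?U \<Otimes>\<^sub>M ?P" "\<lambda>_. ?U" "\<lambda>p. fst p"]
    by (auto simp: cube_def case_prod_unfold)
  let ?A = "?upd -` ?B \<inter> space (?U \<Otimes>\<^sub>M ?P)"
  have A: "?A \<in> sets (?U \<Otimes>\<^sub>M ?P)" using upd B by (rule measurable_sets)
  have "emeasure cube ?B = emeasure (?U \<Otimes>\<^sub>M ?P) ?A"
    using emeasure_distr[OF upd B] cube by simp
  also have "\<dots> = (\<integral>\<^sup>+\<xi>. emeasure ?U ((\<lambda>x. (x, \<xi>)) -` ?A) \<partial>?P)"
    using A by (rule UP.emeasure_pair_measure_alt2)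
  also have "\<dots> \<le> (\<integral>\<^sup>+\<xi>. ennreal (2 * \<tau> / \<bar>c k\<bar>) \<partial>?P)"
  proof (rule nn_integral_mono)
    fix \<xi> assume \<xi>: "\<xi> \<in> space ?P"
    let ?a = "\<Sum>j. (\<xi>(k := 0)) j * c j"
    have "(\<lambda>x. (x, \<xi>)) -` ?A \<subseteq> {x \<in> {0..1}. \<bar>x * c k + ?a\<bar> \<le> \<tau>}"
    proof
      fix x assume "x \<in> (\<lambda>x. (x, \<xi>)) -` ?A"
      then have x: "x \<in> {0..1}" "\<bar>\<Sum>j. (\<xi>(k := x)) j * c j\<bar> \<le> \<tau>"
        using \<xi> by (auto simp: space_pair_measure fun_upd_def)
      have "\<xi>(k := 0) \<in> space cube"
        using \<xi> by (auto simp: space_cube space_PiM PiE_iff)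
      then have sm0: "summable (\<lambda>j. (\<xi>(k := 0)) j * c j)" using sm by (rule summable_cube)
      have "(\<lambda>j. (if j = k then x * c j else 0) + (\<xi>(k := 0)) j * c j) sums (x * c k + ?a)"
        by (intro sums_add sums_single summable_sums sm0)
      moreover have "(\<lambda>j. (if j = k then x * c j else 0) + (\<xi>(k := 0)) j * c j)
          = (\<lambda>j. (\<xi>(k := x)) j * c j)"
        by auto
      ultimately have "(\<Sum>j. (\<xi>(k := x)) j * c j) = x * c k + ?a"
        by (simp add: sums_iff)
      with x show "x \<in> {x \<in> {0..1}. \<bar>x * c k + ?a\<bar> \<le> \<tau>}" by simp
    qed
    then show "emeasure ?U ((\<lambda>x. (x, \<xi>)) -` ?A) \<le> ennreal (2 * \<tau> / \<bar>c k\<bar>)"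
      by (rule emeasure_slab_le[OF ck \<tau>])
  qed
  also have "\<dots> = ennreal (2 * \<tau> / \<bar>c k\<bar>)"
    by (simp add: P.emeasure_space_1)
  finally show ?thesis .
qed

text \<open>A union bound over countably many finite families.  The point of taking \<open>N\<close> independent copies of
  the random sequence is that failure at \<open>p\<close> means failure of all copies, an event of probability at
  most \<open>\<eta>\<^sup>N\<close>.\<close>

lemma exists_coefficients_avoiding_slabs:
  fixes F :: "nat \<Rightarrow> 'p set" and c :: "'p \<Rightarrow> nat \<Rightarrow> real" and \<tau> \<eta> :: "nat \<Rightarrow> real"
  assumes fin: "\<And>n. finite (F n)"
    and sm: "\<And>n p. p \<in> F n \<Longrightarrow> summable (\<lambda>j. \<bar>c p j\<bar>)"
    and small: "\<And>n p. p \<in> F n \<Longrightarrow> \<exists>k. c p k \<noteq> 0 \<and> 2 * \<tau> n / \<bar>c p k\<bar> \<le> \<eta> n"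
    and pos: "\<And>n. 0 \<le> \<tau> n" "\<And>n. 0 \<le> \<eta> n"
    and total: "summable (\<lambda>n. real (card (F n)) * \<eta> n ^ N)" "(\<Sum>n. real (card (F n)) * \<eta> n ^ N) < 1"
  shows "\<exists>\<Xi>. (\<forall>i<N. \<Xi> i \<in> space cube) \<and> (\<forall>n. \<forall>p\<in>F n. \<exists>i<N. \<tau> n < \<bar>\<Sum>j. \<Xi> i j * c p j\<bar>)"
proof -
  interpret C: prob_space cube by (rule prob_space_cube)
  let ?Q = "\<Pi>\<^sub>M i\<in>{..<N}. cube"
  interpret Q: prob_space ?Q by (rule prob_space_PiM) (rule prob_space_cube)
  interpret product_sigma_finite "\<lambda>_::nat. cube" ..
  let ?B = "\<lambda>n p. {\<xi> \<in> space cube. \<bar>\<Sum>j. \<xi> j * c p j\<bar> \<le> \<tau> n}"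
  let ?E = "\<lambda>n p. {..<N} \<rightarrow>\<^sub>E ?B n p"
  have B: "?B n p \<in> sets cube" for n p by measurable
  have E: "?E n p \<in> sets ?Q" for n p using B by (intro sets_PiM_I_finite) auto
  have "emeasure ?Q (?E n p) \<le> ennreal (\<eta> n ^ N)" if p: "p \<in> F n" for n p
  proof -
    obtain k where k: "c p k \<noteq> 0" "2 * \<tau> n / \<bar>c p k\<bar> \<le> \<eta> n" using small[OF p] by blast
    have "emeasure ?Q (?E n p) = emeasure cube (?B n p) ^ N"
      using B by (subst emeasure_PiM) auto
    also have "\<dots> \<le> ennreal (\<eta> n) ^ N"
      using small_ball_cube[OF sm[OF p] k(1) pos(1)[of n]] k(2)
      by (intro power_mono) (auto intro: order_trans ennreal_leI)
    finally show ?thesis using pos by (simp add: ennreal_power)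
  qed
  note Ebd = this
  define G where "G n = (\<Union>p\<in>F n. ?E n p)" for n
  have G: "G n \<in> sets ?Q" for n unfolding G_def using fin E by (intro sets.finite_UN) auto
  have "emeasure ?Q (G n) \<le> ennreal (real (card (F n)) * \<eta> n ^ N)" for n
  proof -
    have "emeasure ?Q (G n) \<le> (\<Sum>p\<in>F n. emeasure ?Q (?E n p))"
      unfolding G_def using E fin by (intro emeasure_subadditive_finite) auto
    also have "\<dots> \<le> (\<Sum>p\<in>F n. ennreal (\<eta> n ^ N))" by (intro sum_mono Ebd)
    also have "\<dots> = ennreal (real (card (F n)) * \<eta> n ^ N)"
      using pos by (simp add: ennreal_mult ennreal_of_nat_eq_real_of_nat)
    finally show ?thesis .
  qed
  then have "(\<Sum>n. emeasure ?Q (G n)) \<le> (\<Sum>n. ennreal (real (card (F n)) * \<eta> n ^ N))"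
    by (intro suminf_le) auto
  also have "\<dots> = ennreal (\<Sum>n. real (card (F n)) * \<eta> n ^ N)"
    using pos total(1) by (intro suminf_ennreal2) auto
  also have "\<dots> < 1" using total(2) by (simp add: ennreal_less_one_iff)
  finally have "emeasure ?Q (\<Union>n. G n) < 1"
    using emeasure_subadditive_countably[of G ?Q] G by (auto intro: le_less_trans)
  then have "(\<Union>n. G n) \<noteq> space ?Q" using Q.emeasure_space_1 by auto
  moreover have "(\<Union>n. G n) \<subseteq> space ?Q" using G sets.sets_into_space by blast
  ultimately obtain \<Xi> where \<Xi>: "\<Xi> \<in> space ?Q" "\<And>n. \<Xi> \<notin> G n" by blast
  show ?thesis
  proof (intro exI[of _ \<Xi>] conjI allI impI ballI)
    show "\<Xi> i \<in> space cube" if "i < N" for i using \<Xi>(1) that by (auto simp: space_PiM)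
    fix n p assume "p \<in> F n"
    then have "\<Xi> \<notin> ?E n p" using \<Xi>(2)[of n] by (auto simp: G_def)
    then show "\<exists>i<N. \<tau> n < \<bar>\<Sum>j. \<Xi> i j * c p j\<bar>"
      using \<Xi>(1) by (force simp: space_PiM PiE_iff not_le)
  qed
qed

section \<open>Nets and norming points for dyadic annuli\<close>

lemma compact_metric_bounded:
  assumes "compact_space (mtopology_of X)"
  obtains R :: real where "1 \<le> R" "\<And>x y. x \<in> mspace X \<Longrightarrow> y \<in> mspace X \<Longrightarrow> mdist X x y < R"
proof -
  interpret Metric_space "mspace X" "mdist X" by simp
  have "mbounded (mspace X)"
    using assms by (intro compactin_imp_mbounded) (simp add: compact_space_def mtopology_of_def)
  then obtain b where "\<And>x y. x \<in> mspace X \<Longrightarrow> y \<in> mspace X \<Longrightarrow> mdist X x y \<le> b"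
    by (auto simp: mbounded_alt)
  then have "mdist X x y < max 1 (b + 1)" if "x \<in> mspace X" "y \<in> mspace X" for x y
    using \<open>\<And>x y. x \<in> mspace X \<Longrightarrow> y \<in> mspace X \<Longrightarrow> mdist X x y \<le> b\<close>[OF that] by simp
  then show thesis by (intro that[of "max 1 (b + 1)"]) auto
qed

definition annulus :: "'a metric \<Rightarrow> real \<Rightarrow> ('a \<times> 'a) set" where
  "annulus X r = {p \<in> mspace X \<times> mspace X. r / 2 \<le> mdist X (fst p) (snd p) \<and> mdist X (fst p) (snd p) < r}"

lemma in_dyadic_annulus:
  assumes "x \<in> mspace X" "y \<in> mspace X" "x \<noteq> y" "mdist X x y < R"
  obtains n where "(x, y) \<in> annulus X (R / 2 ^ n)"
proof -
  let ?d = "mdist X x y"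
  have d: "0 < ?d" using assms mdist_nonneg[of X x y] mdist_zero[of x X y] by linarith
  let ?P = "\<lambda>n. R / 2 ^ n \<le> ?d"
  obtain m where "R / ?d < 2 ^ m" using real_arch_pow[of 2 "R / ?d"] by auto
  then have "?P m" using d by (simp add: field_simps)
  then have L: "?P (Least ?P)" by (rule LeastI)
  moreover have "\<not> ?P 0" using assms by simp
  ultimately have "Least ?P \<noteq> 0" by metis
  then obtain n where n: "Least ?P = Suc n" using not0_implies_Suc by blast
  then have "\<not> ?P n" by (metis lessI not_less_Least)
  moreover have "R / 2 ^ n / 2 \<le> ?d" using L n by (simp add: field_simps)
  ultimately show thesis using that[of n] assms by (auto simp: annulus_def)
qed

text \<open>Covering balls need not be centred in the set that they cover.  Moving the centres into the set,
  at the price of doubling the radius, is needed because the small ball estimate applies to elements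
  of the annulus only.\<close>

lemma centred_net:
  fixes \<rho> :: real
  assumes "finite P" "\<And>a. a \<in> A \<Longrightarrow> \<exists>p\<in>P. \<forall>z\<in>Z. \<bar>g a z - g p z\<bar> < \<rho>"
  obtains F where "finite F" "F \<subseteq> A" "card F \<le> card P"
    "\<And>a. a \<in> A \<Longrightarrow> \<exists>b\<in>F. \<forall>z\<in>Z. \<bar>g a z - g b z\<bar> \<le> 2 * \<rho>"
proof -
  let ?near = "\<lambda>a p. \<forall>z\<in>Z. \<bar>g a z - g p z\<bar> < \<rho>"
  let ?P = "{p \<in> P. \<exists>a\<in>A. ?near a p}"
  define h where "h p = (SOME a. a \<in> A \<and> ?near a p)" for p
  have h: "h p \<in> A" "?near (h p) p" if "p \<in> ?P" for p
  proof -
    have "\<exists>a. a \<in> A \<and> ?near a p" using that by blast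
    then have "h p \<in> A \<and> ?near (h p) p" unfolding h_def by (rule someI_ex)
    then show "h p \<in> A" "?near (h p) p" by auto
  qed
  show thesis
  proof
    show "finite (h ` ?P)" using assms by simp
    show "h ` ?P \<subseteq> A" using h by blast
    show "card (h ` ?P) \<le> card P"
      by (rule order_trans[OF card_image_le card_mono]) (use assms(1) in auto)
    fix a assume a: "a \<in> A"
    then obtain p where p: "p \<in> P" "?near a p" using assms(2) by blast
    then have pP: "p \<in> ?P" using a by blast
    have "\<bar>g a z - g (h p) z\<bar> \<le> 2 * \<rho>" if "z \<in> Z" for z
      using bspec[OF p(2) that] bspec[OF h(2)[OF pP] that] by linarith
    then show "\<exists>b\<in>h ` ?P. \<forall>z\<in>Z. \<bar>g a z - g b z\<bar> \<le> 2 * \<rho>" using pP by blast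
  qed
qed

lemma Suc_prod_encode_le: "Suc (prod_encode (n, k)) \<le> (n + k + 1)\<^sup>2"
proof -
  have "2 * triangle (n + k) = (n + k) * (n + k + 1)"
    unfolding triangle_def by simp
  then show ?thesis by (simp add: prod_encode_def power2_eq_square algebra_simps)
qed

text \<open>If \<open>p'\<close> is within \<open>r/8\<close> of a pair \<open>p\<close> of the annulus, then the norm of \<open>p'\<close> is at least \<open>3r/8\<close> and is
  attained at \<open>snd p'\<close>, so \<open>p\<close> has absolute value at least \<open>r/4\<close> there.  The second points of a net with constant
  ratio of radii thus suffice.  They are listed for all \<open>n\<close> at once along the pairing function, which is
  quadratic, so the index stays polynomial in \<open>n\<close>.\<close>

lemma norming_sequence:
  fixes R C :: real and S B :: nat
  assumes R: "1 \<le> R" and C: "1 \<le> C" and ne: "mspace X \<noteq> {}"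
    and cov: "polynomially_covered X R C S B"
  obtains z :: "nat \<Rightarrow> 'a" and A :: real and E :: nat where "1 \<le> A" "\<And>j. z j \<in> mspace X"
    "\<And>n p. p \<in> annulus X (R / 2 ^ n) \<Longrightarrow>
       \<exists>j. real j + 1 \<le> A * (real n + 1) ^ E \<and> R / 2 ^ n / 4 \<le> \<bar>pair_gap X p (z j)\<bar>"
proof -
  define D where "D = C * 8 ^ S"
  have D: "1 \<le> D" using mult_mono[of 1 C 1 "8 ^ S :: real"] C by (simp add: D_def)
  have "\<forall>n. \<exists>P \<subseteq> mspace X \<times> mspace X. finite P \<and> real (card P) \<le> D * (real n + 1) ^ B \<and>
       (\<forall>p \<in> mspace X \<times> mspace X. mdist X (fst p) (snd p) < R / 2 ^ n \<longrightarrow>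
          (\<exists>p' \<in> P. \<forall>z \<in> mspace X. \<bar>pair_gap X p z - pair_gap X p' z\<bar> < R / 2 ^ n / 8))"
    using cov[unfolded polynomially_covered_def, rule_format, of 8] by (simp add: D_def)
  then obtain P where P: "\<And>n. P n \<subseteq> mspace X \<times> mspace X" "\<And>n. finite (P n)"
      "\<And>n. real (card (P n)) \<le> D * (real n + 1) ^ B"
    and near: "\<And>n p. p \<in> mspace X \<times> mspace X \<Longrightarrow> mdist X (fst p) (snd p) < R / 2 ^ n \<Longrightarrow>
          \<exists>p' \<in> P n. \<forall>z \<in> mspace X. \<bar>pair_gap X p z - pair_gap X p' z\<bar> < R / 2 ^ n / 8"
    by metis
  obtain e where e: "\<And>n. bij_betw (e n) {0..<card (P n)} (P n)"
    using ex_bij_betw_nat_finite[OF P(2)] by metis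
  obtain x0 where x0: "x0 \<in> mspace X" using ne by auto
  \<comment> \<open>Pairs \<open>(n, k)\<close> with \<open>k\<close> beyond the size of the \<open>n\<close>-th net get an arbitrary point.\<close>
  define z where "z j = (case prod_decode j of (n, k) \<Rightarrow> if k < card (P n) then snd (e n k) else x0)" for j
  show thesis
  proof
    have "1 \<le> D + 1" using D by simp
    then show "1 \<le> (D + 1)\<^sup>2" by (rule one_le_power)
    show "z j \<in> mspace X" for j
    proof -
      have "e n k \<in> mspace X \<times> mspace X" if "k < card (P n)" for n k
        using bij_betw_apply[OF e[of n], of k] that P(1)[of n] by auto
      then show ?thesis using x0 by (auto simp: z_def mem_Times_iff split: prod.split)
    qed
    fix n p assume p: "p \<in> annulus X (R / 2 ^ n)"
    let ?r = "R / 2 ^ n"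
    have pX: "p \<in> mspace X \<times> mspace X" and dp: "?r / 2 \<le> mdist X (fst p) (snd p)" "mdist X (fst p) (snd p) < ?r"
      using p by (auto simp: annulus_def)
    obtain p' where p': "p' \<in> P n" "\<And>z. z \<in> mspace X \<Longrightarrow> \<bar>pair_gap X p z - pair_gap X p' z\<bar> < ?r / 8"
      using near[OF pX dp(2)] by blast
    have p'X: "p' \<in> mspace X \<times> mspace X" using p'(1) P(1) by blast
    have "pair_gap X p (snd p) - pair_gap X p' (snd p) < ?r / 8"
      using p'(2)[of "snd p"] pX by (auto simp: abs_less_iff)
    moreover have "pair_gap X p' (snd p) \<le> mdist X (fst p') (snd p')"
      using abs_pair_gap_le[OF p'X, of "snd p"] pX by (auto simp: abs_le_iff)
    moreover have "pair_gap X p' (snd p') - pair_gap X p (snd p') < ?r / 8"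
      using p'(2)[of "snd p'"] p'X by (auto simp: abs_less_iff)
    moreover have "r / 4 \<le> d" if "a - b < r / 8" "b \<le> c" "c - d < r / 8" "r / 2 \<le> a" for r a b c d :: real
      using that by linarith
    ultimately have "?r / 4 \<le> pair_gap X p (snd p')"
      using pair_gap_snd[OF pX] pair_gap_snd[OF p'X] dp(1) by metis
    then have big: "?r / 4 \<le> \<bar>pair_gap X p (snd p')\<bar>" by linarith
    have "p' \<in> e n ` {0..<card (P n)}" using p'(1) bij_betw_imp_surj_on[OF e[of n]] by simp
    then obtain k where k: "k < card (P n)" "e n k = p'" by auto
    let ?j = "prod_encode (n, k)" and ?w = "real n + 1"
    have "real (Suc ?j) \<le> real ((n + k + 1)\<^sup>2)"
      by (rule of_nat_mono[OF Suc_prod_encode_le])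
    then have "real ?j + 1 \<le> (real n + real k + 1)\<^sup>2"
      by (simp only: of_nat_Suc of_nat_add of_nat_power of_nat_1 add.commute[of 1])
    also have "\<dots> \<le> ((D + 1) * ?w ^ Suc B)\<^sup>2"
    proof (rule power_mono)
      have "real k \<le> D * ?w ^ B" using k(1) P(3)[of n] by linarith
      also have "\<dots> \<le> D * ?w ^ Suc B" using D by (intro mult_left_mono power_increasing) auto
      finally have "real k \<le> D * ?w ^ Suc B" .
      moreover have "?w ^ 1 \<le> ?w ^ Suc B" by (intro power_increasing) auto
      ultimately show "real n + real k + 1 \<le> (D + 1) * ?w ^ Suc B" by (simp add: distrib_right)
    qed simp
    also have "\<dots> = (D + 1)\<^sup>2 * ?w ^ (Suc B * 2)" by (simp only: power_mult_distrib power_mult)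
    finally have "real ?j + 1 \<le> (D + 1)\<^sup>2 * ?w ^ (Suc B * 2)" .
    moreover have "z ?j = snd p'" using k by (simp add: z_def)
    ultimately show "\<exists>j. real j + 1 \<le> (D + 1)\<^sup>2 * ?w ^ (Suc B * 2) \<and> ?r / 4 \<le> \<bar>pair_gap X p (z j)\<bar>"
      using big by (intro exI[of _ ?j]) simp
  qed
qed

section \<open>Random Lipschitz functionals that separate points\<close>

lemma weight_sums: "(\<lambda>j. 1 / (real j + 1)\<^sup>2) sums (pi\<^sup>2 / 6)" and weight_suminf_le: "(\<Sum>j. 1 / (real j + 1)\<^sup>2) \<le> 4"
proof -
  show s: "(\<lambda>j. 1 / (real j + 1)\<^sup>2) sums (pi\<^sup>2 / 6)"
    using inverse_squares_sums by (simp add: add.commute)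
  have "pi\<^sup>2 \<le> 4\<^sup>2" using pi_less_4 by (intro power_mono) auto
  then show "(\<Sum>j. 1 / (real j + 1)\<^sup>2) \<le> 4" using sums_unique[OF s] by simp
qed

lemma weighted_summable:
  assumes "\<And>j. \<bar>g j\<bar> \<le> (b::real)"
  shows "summable (\<lambda>j. \<bar>g j / (real j + 1)\<^sup>2\<bar>)"
proof (rule summable_comparison_test'[where g = "\<lambda>j. b * (1 / (real j + 1)\<^sup>2)"])
  show "summable (\<lambda>j. b * (1 / (real j + 1)\<^sup>2))" by (intro summable_mult sums_summable[OF weight_sums])
qed (use assms in \<open>auto intro!: divide_right_mono simp: abs_divide\<close>)

lemma weighted_suminf_le:
  assumes \<xi>: "\<xi> \<in> space cube" and g: "\<And>j. \<bar>g j\<bar> \<le> b"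
  shows "\<bar>\<Sum>j. \<xi> j * (g j / (real j + 1)\<^sup>2)\<bar> \<le> 4 * b"
proof -
  have b: "0 \<le> b" using g[of 0] by linarith
  have bound: "norm (\<xi> j * (g j / (real j + 1)\<^sup>2)) \<le> b * (1 / (real j + 1)\<^sup>2)" for j
  proof -
    have "0 \<le> \<xi> j" "\<xi> j \<le> 1" using \<xi> by (auto simp: space_cube PiE_iff)
    then have "\<xi> j * (\<bar>g j\<bar> / (real j + 1)\<^sup>2) \<le> 1 * (b / (real j + 1)\<^sup>2)"
      using g by (intro mult_mono divide_right_mono) auto
    with \<open>0 \<le> \<xi> j\<close> show ?thesis by (simp add: abs_mult abs_divide)
  qed
  have "norm (\<Sum>j. \<xi> j * (g j / (real j + 1)\<^sup>2)) \<le> (\<Sum>j. b * (1 / (real j + 1)\<^sup>2))"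
    by (intro norm_suminf_le bound summable_mult sums_summable[OF weight_sums])
  also have "\<dots> = b * (\<Sum>j. 1 / (real j + 1)\<^sup>2)"
    by (intro suminf_mult sums_summable[OF weight_sums])
  also have "\<dots> \<le> b * 4" using b by (intro mult_left_mono weight_suminf_le)
  finally show ?thesis by simp
qed

text \<open>The \<open>n\<close>-th term of the union bound, with \<open>w = n + 1\<close>: cardinality of the fine net times the
  \<open>N\<close>-th power of the failure probability.  The exponent \<open>N\<close> contains \<open>q S + B\<close> to cancel the
  powers of \<open>w\<close> in the cardinality, \<open>2\<close> to make the terms summable, and \<open>S\<close> to cancel \<open>1 / \<delta> ^ S\<close>;
  a factor \<open>\<delta>\<close> is left over, which makes the sum as small as desired.\<close>

lemma union_bound_term_le:
  fixes C a \<delta> w :: real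
  assumes "0 \<le> C" "0 \<le> a" "0 < \<delta>" "\<delta> \<le> 1" "1 \<le> w" "N = q * S + B + 2 + S"
  shows "C * (16 * w ^ q / \<delta>) ^ S * w ^ B * (a * \<delta> / w) ^ N \<le> C * 16 ^ S * a ^ N * \<delta> / w\<^sup>2"
proof -
  have \<delta>N: "\<delta> ^ N = \<delta> ^ S * (\<delta> * \<delta> ^ (q * S + B + 1))"
    and wN: "w ^ N = w ^ (q * S) * w ^ B * (w\<^sup>2 * w ^ S)"
    by (simp_all add: assms(6) power_add power2_eq_square)
  have "C * (16 * w ^ q / \<delta>) ^ S * w ^ B * (a * \<delta> / w) ^ N
      = C * 16 ^ S * a ^ N * \<delta> / w\<^sup>2 * (\<delta> ^ (q * S + B + 1) / w ^ S)"
    unfolding power_divide power_mult_distrib power_mult[symmetric] \<delta>N wN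
    using assms by (simp add: field_simps)
  also have "\<dots> \<le> C * 16 ^ S * a ^ N * \<delta> / w\<^sup>2 * 1"
  proof (rule mult_left_mono)
    have "\<delta> ^ (q * S + B + 1) \<le> 1" by (rule power_le_one) (use assms in auto)
    also have "1 \<le> w ^ S" using assms by (intro one_le_power)
    finally show "\<delta> ^ (q * S + B + 1) / w ^ S \<le> 1" using assms by (simp add: divide_le_eq_1)
  qed (use assms in auto)
  finally show ?thesis by simp
qed

text \<open>The coefficients are chosen to be large on the pairs of a fine net; since the functionals are
  Lipschitz, half of the bound carries over to all pairs of the annulus.\<close>

lemma exists_separating_coefficients:
  fixes R C :: real and S B :: nat
  assumes R: "1 \<le> R" and C: "1 \<le> C" and ne: "mspace X \<noteq> {}"
    and cov: "polynomially_covered X R C S B"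
  obtains z :: "nat \<Rightarrow> 'a" and \<Xi> :: "nat \<Rightarrow> nat \<Rightarrow> real" and N q :: nat and \<delta> :: real
  where "\<And>j. z j \<in> mspace X" "\<And>i. i < N \<Longrightarrow> \<Xi> i \<in> space cube" "1 \<le> N" "0 < \<delta>"
    "\<And>n p. p \<in> annulus X (R / 2 ^ n) \<Longrightarrow>
       \<exists>i<N. R / 2 ^ n * \<delta> / (real n + 1) ^ q \<le> \<bar>\<Sum>j. \<Xi> i j * (pair_gap X p (z j) / (real j + 1)\<^sup>2)\<bar>"
proof -
  obtain z :: "nat \<Rightarrow> 'a" and A :: real and E :: nat where A: "1 \<le> A" and z: "\<And>j. z j \<in> mspace X"
    and norming: "\<And>n p. p \<in> annulus X (R / 2 ^ n) \<Longrightarrow>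
       \<exists>j. real j + 1 \<le> A * (real n + 1) ^ E \<and> R / 2 ^ n / 4 \<le> \<bar>pair_gap X p (z j)\<bar>"
    by (rule norming_sequence[OF R C ne cov]) (rule that)
  \<comment> \<open>The weights at the norming indices are at least a constant times \<open>1 / w ^ (2 * E)\<close>; the additional 1 makes the failure
    probability \<open>\<eta>\<close> decay like \<open>1 / w\<close>.\<close>
  define q where "q = 2 * E + 1"
  define N where "N = q * S + B + 2 + S"
  define G where "G = C * 16 ^ S * (8 * A\<^sup>2) ^ N"
  define \<delta> where "\<delta> = 1 / (8 * G)"
  define r where "r n = R / 2 ^ n" for n :: nat
  define w where "w n = real n + 1" for n :: nat
  define \<tau> where "\<tau> n = r n * \<delta> / w n ^ q" for n
  define \<eta> where "\<eta> n = 8 * A\<^sup>2 * \<delta> / w n" for n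
  \<comment> \<open>Fine enough for two pairs at distance \<open>2 r / t\<close> to have values that differ by at most
    \<open>4 * (2 r / t) = \<tau> / 2\<close>.\<close>
  define t where "t n = 16 * w n ^ q / \<delta>" for n
  define c where "c p j = pair_gap X p (z j) / (real j + 1)\<^sup>2" for p j
  have "1 \<le> A\<^sup>2" using A by simp
  then have "1 * 1 * 1 \<le> G" unfolding G_def using C by (intro mult_mono one_le_power) auto
  then have G: "1 \<le> G" by simp
  have \<delta>: "0 < \<delta>" "\<delta> \<le> 1" using G by (auto simp: \<delta>_def)
  have w: "1 \<le> w n" for n by (simp add: w_def)
  have r: "0 < r n" for n using R by (simp add: r_def)
  have t: "1 < t n" for n
  proof -
    have "\<delta> < 16 * w n ^ q" using \<delta> one_le_power[OF w, of n q] by linarith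
    then show ?thesis using \<delta> by (simp add: t_def)
  qed
  have "\<exists>F. finite F \<and> F \<subseteq> annulus X (r n) \<and> real (card F) \<le> C * t n ^ S * w n ^ B \<and>
     (\<forall>a\<in>annulus X (r n). \<exists>b\<in>F. \<forall>z\<in>mspace X. \<bar>pair_gap X a z - pair_gap X b z\<bar> \<le> 2 * (r n / t n))" for n
  proof -
    obtain P where P: "finite P" "real (card P) \<le> C * t n ^ S * w n ^ B"
      and near: "\<And>p. p \<in> mspace X \<times> mspace X \<Longrightarrow> mdist X (fst p) (snd p) < r n \<Longrightarrow>
          \<exists>p' \<in> P. \<forall>z \<in> mspace X. \<bar>pair_gap X p z - pair_gap X p' z\<bar> < r n / t n"
      using cov[unfolded polynomially_covered_def, rule_format, OF t, of n] unfolding r_def w_def by metis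
    have near': "\<exists>p\<in>P. \<forall>z\<in>mspace X. \<bar>pair_gap X a z - pair_gap X p z\<bar> < r n / t n"
      if "a \<in> annulus X (r n)" for a
      using near[of a] that by (auto simp: annulus_def)
    obtain F where "finite F" "F \<subseteq> annulus X (r n)" "card F \<le> card P"
      "\<And>a. a \<in> annulus X (r n) \<Longrightarrow> \<exists>b\<in>F. \<forall>z\<in>mspace X. \<bar>pair_gap X a z - pair_gap X b z\<bar> \<le> 2 * (r n / t n)"
      using centred_net[OF P(1) near'] by blast
    moreover have "real (card F) \<le> C * t n ^ S * w n ^ B" using \<open>card F \<le> card P\<close> P(2) by linarith
    ultimately show ?thesis by blast
  qed
  then obtain F where F: "\<And>n. finite (F n)" "\<And>n. F n \<subseteq> annulus X (r n)"
      "\<And>n. real (card (F n)) \<le> C * t n ^ S * w n ^ B"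
    and near: "\<And>n a. a \<in> annulus X (r n) \<Longrightarrow>
        \<exists>b\<in>F n. \<forall>z\<in>mspace X. \<bar>pair_gap X a z - pair_gap X b z\<bar> \<le> 2 * (r n / t n)"
    by metis
  have gap_le: "\<bar>pair_gap X p (z j)\<bar> \<le> r n" if "p \<in> annulus X (r n)" for n p j
    using abs_pair_gap_le[of p X "z j"] that z by (auto simp: annulus_def)
  have pos: "0 \<le> \<tau> n" "0 \<le> \<eta> n" for n
    using r[of n] w[of n] \<delta> by (auto simp: \<tau>_def \<eta>_def intro!: divide_nonneg_nonneg mult_nonneg_nonneg)
  have summand: "real (card (F n)) * \<eta> n ^ N \<le> (1 / 8) * (1 / (real n + 1)\<^sup>2)" for n
  proof -
    have "real (card (F n)) * \<eta> n ^ N \<le> C * t n ^ S * w n ^ B * \<eta> n ^ N"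
      using F(3) pos by (intro mult_right_mono) auto
    also have "\<dots> \<le> C * 16 ^ S * (8 * A\<^sup>2) ^ N * \<delta> / (w n)\<^sup>2"
      unfolding t_def \<eta>_def by (rule union_bound_term_le) (use C \<delta> w N_def in auto)
    also have "C * 16 ^ S * (8 * A\<^sup>2) ^ N * \<delta> = 1 / 8" unfolding G_def[symmetric] \<delta>_def using G by simp
    finally show ?thesis by (simp add: w_def)
  qed
  have sm_w: "summable (\<lambda>n. (1 / 8) * (1 / (real n + 1)\<^sup>2))"
    by (intro summable_mult sums_summable[OF weight_sums])
  have "\<exists>\<Xi>. (\<forall>i<N. \<Xi> i \<in> space cube) \<and> (\<forall>n. \<forall>p\<in>F n. \<exists>i<N. \<tau> n < \<bar>\<Sum>j. \<Xi> i j * c p j\<bar>)"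
  proof (rule exists_coefficients_avoiding_slabs)
    show sm: "summable (\<lambda>n. real (card (F n)) * \<eta> n ^ N)"
      using summand pos by (intro summable_comparison_test'[OF sm_w]) auto
    have "(\<Sum>n. real (card (F n)) * \<eta> n ^ N) \<le> (\<Sum>n. (1 / 8) * (1 / (real n + 1)\<^sup>2))"
      by (intro suminf_le summand sm sm_w)
    also have "\<dots> = (1 / 8) * (\<Sum>n. 1 / (real n + 1)\<^sup>2)"
      by (rule suminf_mult[OF sums_summable[OF weight_sums]])
    also have "\<dots> < 1" using weight_suminf_le by simp
    finally show "(\<Sum>n. real (card (F n)) * \<eta> n ^ N) < 1" .
  next
    fix n p assume "p \<in> F n"
    then have p: "p \<in> annulus X (r n)" using F(2) by blast
    show "summable (\<lambda>j. \<bar>c p j\<bar>)" unfolding c_def by (rule weighted_summable) (rule gap_le[OF p])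
    obtain k where k: "real k + 1 \<le> A * w n ^ E" "r n / 4 \<le> \<bar>pair_gap X p (z k)\<bar>"
      using norming[of p n] p by (auto simp: r_def w_def)
    have "r n / (4 * (A\<^sup>2 * w n ^ (2 * E))) = (r n / 4) / (A * w n ^ E)\<^sup>2"
      by (simp add: power_mult_distrib power_mult[symmetric] mult.commute)
    also have "\<dots> \<le> \<bar>pair_gap X p (z k)\<bar> / (real k + 1)\<^sup>2"
      using k r[of n] by (intro frac_le power_mono) auto
    also have "\<dots> = \<bar>c p k\<bar>" by (simp add: c_def abs_divide)
    finally have ck: "r n / (4 * (A\<^sup>2 * w n ^ (2 * E))) \<le> \<bar>c p k\<bar>" .
    have pos_ck: "0 < r n / (4 * (A\<^sup>2 * w n ^ (2 * E)))" using r[of n] w[of n] A by simp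
    have "2 * \<tau> n / \<bar>c p k\<bar> \<le> 2 * \<tau> n / (r n / (4 * (A\<^sup>2 * w n ^ (2 * E))))"
      using pos ck pos_ck by (intro frac_le) auto
    also have "\<dots> = \<eta> n"
      using r[of n] w[of n] A by (simp add: \<tau>_def \<eta>_def q_def field_simps)
    finally show "\<exists>k. c p k \<noteq> 0 \<and> 2 * \<tau> n / \<bar>c p k\<bar> \<le> \<eta> n" using ck pos_ck by (intro exI[of _ k]) auto
  qed (use F pos in auto)
  then obtain \<Xi> where \<Xi>: "\<And>i. i < N \<Longrightarrow> \<Xi> i \<in> space cube"
    and avoid: "\<And>n p. p \<in> F n \<Longrightarrow> \<exists>i<N. \<tau> n < \<bar>\<Sum>j. \<Xi> i j * c p j\<bar>"
    by blast
  show thesis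
  proof (rule that[of z N \<Xi> "\<delta> / 2" q])
    fix n p assume "p \<in> annulus X (R / 2 ^ n)"
    then have p: "p \<in> annulus X (r n)" by (simp add: r_def)
    obtain p' where p': "p' \<in> F n" "\<And>z. z \<in> mspace X \<Longrightarrow> \<bar>pair_gap X p z - pair_gap X p' z\<bar> \<le> 2 * (r n / t n)"
      using near[OF p] by blast
    obtain i where i: "i < N" "\<tau> n < \<bar>\<Sum>j. \<Xi> i j * c p' j\<bar>" using avoid[OF p'(1)] by blast
    have p'X: "p' \<in> annulus X (r n)" using p'(1) F(2) by blast
    have sm: "summable (\<lambda>j. \<Xi> i j * c a j)" if "a \<in> annulus X (r n)" for a
      unfolding c_def by (intro summable_cube[OF \<Xi>[OF i(1)]] weighted_summable) (rule gap_le[OF that])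
    have "(\<Sum>j. \<Xi> i j * c p j) - (\<Sum>j. \<Xi> i j * c p' j) = (\<Sum>j. \<Xi> i j * c p j - \<Xi> i j * c p' j)"
      by (intro suminf_diff sm p p'X)
    also have "\<dots> = (\<Sum>j. \<Xi> i j * ((pair_gap X p (z j) - pair_gap X p' (z j)) / (real j + 1)\<^sup>2))"
      by (simp add: c_def right_diff_distrib diff_divide_distrib)
    finally have "\<bar>(\<Sum>j. \<Xi> i j * c p j) - (\<Sum>j. \<Xi> i j * c p' j)\<bar> \<le> 4 * (2 * (r n / t n))"
      using weighted_suminf_le[OF \<Xi>[OF i(1)], of "\<lambda>j. pair_gap X p (z j) - pair_gap X p' (z j)" "2 * (r n / t n)"] p'(2) z by simp
    also have "4 * (2 * (r n / t n)) = \<tau> n / 2"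
      using \<delta> w[of n] by (simp add: t_def \<tau>_def mult.commute)
    finally have "\<tau> n / 2 \<le> \<bar>\<Sum>j. \<Xi> i j * c p j\<bar>" using i(2) by linarith
    then show "\<exists>i<N. R / 2 ^ n * (\<delta> / 2) / (real n + 1) ^ q \<le> \<bar>\<Sum>j. \<Xi> i j * (pair_gap X p (z j) / (real j + 1)\<^sup>2)\<bar>"
      using i(1) by (auto simp: \<tau>_def r_def w_def c_def)
  qed (use z \<Xi> \<delta> in \<open>auto simp: N_def\<close>)
qed

section \<open>The embedding\<close>

theorem theorem7p3:
  fixes X :: "'a metric"
  assumes "compact_space (mtopology_of X)"
    and "almost_homogeneous (submetric (Linfty X) (distance_differences X))"
  shows "\<exists>N \<ge> 1. \<exists>f. inj_on f (mspace X) \<and> almost_bi_Lipschitz X N f"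
proof (cases "mspace X = {}")
  case True
  then have "almost_bi_Lipschitz X 1 f" for f
    unfolding almost_bi_Lipschitz_def by (auto intro!: exI[of _ 0] exI[of _ 1])
  with True show ?thesis by (intro exI[of _ 1]) auto
next
  case False
  obtain R where R: "1 \<le> R" and diam: "\<And>x y. x \<in> mspace X \<Longrightarrow> y \<in> mspace X \<Longrightarrow> mdist X x y < R"
    by (rule compact_metric_bounded[OF assms(1)]) (rule that)
  obtain C :: real and S B :: nat where C: "1 \<le> C" and
    cov: "polynomially_covered X R C S B"
    by (rule almost_homogeneous_covering[OF assms(2) R]) (rule that)
  obtain z :: "nat \<Rightarrow> 'a" and \<Xi> :: "nat \<Rightarrow> nat \<Rightarrow> real" and N q :: nat and \<delta> :: real
    where z: "\<And>j. z j \<in> mspace X" and \<Xi>: "\<And>i. i < N \<Longrightarrow> \<Xi> i \<in> space cube" and N: "1 \<le> N" and \<delta>: "0 < \<delta>"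
    and sep: "\<And>n p. p \<in> annulus X (R / 2 ^ n) \<Longrightarrow>
       \<exists>i<N. R / 2 ^ n * \<delta> / (real n + 1) ^ q \<le> \<bar>\<Sum>j. \<Xi> i j * (pair_gap X p (z j) / (real j + 1)\<^sup>2)\<bar>"
    by (rule exists_separating_coefficients[OF R C False cov]) (rule that)
  define f where "f x i = (if i < N then \<Sum>j. \<Xi> i j * (mdist X x (z j) / (real j + 1)\<^sup>2) else 0)" for x i
  define K where "K = (4 * R + 4) ^ q / \<delta>"
  define L where "L = K + 4 * real N"
  have K: "0 < K" using R \<delta> by (simp add: K_def)
  have L: "0 < L" "K \<le> L" "4 * real N \<le> L" using K by (auto simp: L_def)
  have f_diff: "f x i - f y i = (\<Sum>j. \<Xi> i j * (pair_gap X (x, y) (z j) / (real j + 1)\<^sup>2))"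
    if "x \<in> mspace X" "y \<in> mspace X" "i < N" for x y i
  proof -
    have "summable (\<lambda>j. \<Xi> i j * (mdist X u (z j) / (real j + 1)\<^sup>2))" if "u \<in> mspace X" for u
      using diam[OF that z] by (intro summable_cube[OF \<Xi>[OF \<open>i < N\<close>]] weighted_summable[of _ R]) (simp add: less_imp_le)
    then have "f x i - f y i = (\<Sum>j. \<Xi> i j * (mdist X x (z j) / (real j + 1)\<^sup>2) - \<Xi> i j * (mdist X y (z j) / (real j + 1)\<^sup>2))"
      using that by (simp add: f_def suminf_diff)
    then show ?thesis by (simp add: pair_gap_def right_diff_distrib diff_divide_distrib)
  qed
  have upper: "L2_set (\<lambda>i. f x i - f y i) {..<N} \<le> L * mdist X x y"
    if "x \<in> mspace X" "y \<in> mspace X" for x y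
  proof -
    have "L2_set (\<lambda>i. f x i - f y i) {..<N} \<le> (\<Sum>i<N. \<bar>f x i - f y i\<bar>)" by (rule L2_set_le_sum_abs)
    also have "\<dots> \<le> (\<Sum>i<N. 4 * mdist X x y)"
    proof (rule sum_mono)
      fix i assume "i \<in> {..<N}"
      then have "i < N" by simp
      show "\<bar>f x i - f y i\<bar> \<le> 4 * mdist X x y"
        unfolding f_diff[OF that \<open>i < N\<close>]
        by (rule weighted_suminf_le[OF \<Xi>[OF \<open>i < N\<close>]]) (use abs_pair_gap_le[of "(x, y)" X] that z in auto)
    qed
    also have "\<dots> \<le> L * mdist X x y" using L by (simp add: mult_right_mono flip: mult.assoc)
    finally show ?thesis .
  qed
  have lower: "1 / L * (mdist X x y / slog (mdist X x y) powr real q) \<le> L2_set (\<lambda>i. f x i - f y i) {..<N}"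
    if xy: "x \<in> mspace X" "y \<in> mspace X" "x \<noteq> y" for x y
  proof -
    let ?d = "mdist X x y"
    have d: "0 < ?d" using xy mdist_nonneg[of X x y] mdist_zero[of x X y] by linarith
    then have sl: "0 < slog ?d" by (rule slog_pos)
    obtain n where n: "(x, y) \<in> annulus X (R / 2 ^ n)"
      by (rule in_dyadic_annulus[OF xy diam[OF xy(1,2)]]) (rule that)
    then have dn: "?d < R / 2 ^ n" by (simp add: annulus_def)
    obtain i where i: "i < N" "R / 2 ^ n * \<delta> / (real n + 1) ^ q \<le> \<bar>f x i - f y i\<bar>"
      using sep[OF n] f_diff[OF xy(1,2)] by auto
    have "1 / L * (?d / slog ?d powr real q) \<le> 1 / K * (?d / slog ?d ^ q)"
      using d sl L K by (auto simp: powr_realpow intro!: mult_right_mono divide_left_mono)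
    also have "\<dots> = ?d * \<delta> / ((4 * R + 4) * slog ?d) ^ q"
      by (simp add: K_def power_mult_distrib)
    also have "\<dots> \<le> R / 2 ^ n * \<delta> / (real n + 1) ^ q"
      using d dn \<delta> R Suc_scale_le_slog[OF R d dn] by (intro frac_le mult_right_mono power_mono) auto
    also have "\<dots> \<le> \<bar>f x i - f y i\<bar>" by (rule i(2))
    also have "\<dots> \<le> L2_set (\<lambda>i. \<bar>f x i - f y i\<bar>) {..<N}"
      using i(1) by (intro member_le_L2_set) auto
    also have "\<dots> = L2_set (\<lambda>i. f x i - f y i) {..<N}" by (simp add: L2_set_def)
    finally show ?thesis .
  qed
  have "inj_on f (mspace X)"
  proof (rule inj_onI, rule ccontr)
    fix x y assume xy: "x \<in> mspace X" "y \<in> mspace X" "f x = f y" "x \<noteq> y"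
    have d: "0 < mdist X x y" using xy mdist_nonneg[of X x y] mdist_zero[of x X y] by linarith
    have "0 < 1 / L * (mdist X x y / slog (mdist X x y) powr real q)"
      using d slog_pos[OF d] L by simp
    also have "\<dots> \<le> 0" using lower[OF xy(1,2,4)] xy(3) by (simp add: L2_set_def)
    finally show False by simp
  qed
  moreover have "almost_bi_Lipschitz X N f"
    unfolding almost_bi_Lipschitz_def
  proof (rule conjI[OF _ exI[of _ "real q", OF exI[of _ L]]])
    show "f \<in> mspace X \<rightarrow> topspace (Euclidean_space N)"
      by (auto simp: topspace_Euclidean_space f_def)
  qed (use L lower upper in auto)
  ultimately show ?thesis using N by blast
qed

end
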